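(* If $X$ is a short game, then there exists a Digraph placement game $G$ such that $G=X$. (That is, the ruleset Digraph placement is universal.)
   Context: All games are short normal-play two-player combinatorial games (Left and Right; no chance or hidden information, bounded length of play, finitely many options at every position, a player unable to move on their turn loses). Equality $Y=Z$ means that for every game $X$ the disjunctive sums $X+Y$ and $X+Z$ (in which each move is made in exactly one component) have the same outcome. A Digraph placement game is played on a finite digraph $G=(V,E)$ with a (not necessarily proper) colouring $V\to\{\text{blue},\text{red}\}$: on her turn Left chooses a remaining blue vertex $v$ and deletes $v$ together with all its out-neighbours; on his turn Right does the same with a remaining red vertex. A player unable to move loses. *)

theory Defs
  imports "HOL-Library.FSet" "Graph_Theory.Graph_Theory"
begin

section \<open>Short games\<close>

text \<open>
  A position of a short game is given by its finite sets of Left options and Right options.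
  A datatype value is a well-founded, finitely branching tree, so \<open>game\<close> consists of exactly the
  short games, each considered as its tree of positions.
\<close>

datatype player = Left | Right

datatype game = Game (left_opts: "game fset") (right_opts: "game fset")

fun opts :: "player \<Rightarrow> game \<Rightarrow> game fset" where
  "opts Left G = left_opts G"
| "opts Right G = right_opts G"

fun opponent :: "player \<Rightarrow> player" where
  "opponent Left = Right"
| "opponent Right = Left"

lemma size_fset_member: "H |\<in>| A \<Longrightarrow> size H < size_fset size A"
  using member_le_sum[of H "fset A" "Suc \<circ> size"] by (simp add: size_fset_simps less_eq_Suc_le)

lemma size_left_option [termination_simp]: "H |\<in>| left_opts G \<Longrightarrow> size H < size G"
  using size_fset_member[of H "left_opts G"] by (cases G) simp

lemma size_right_option [termination_simp]: "H |\<in>| right_opts G \<Longrightarrow> size H < size G"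
  using size_fset_member[of H "right_opts G"] by (cases G) simp

lemma size_option [termination_simp]: "H |\<in>| opts p G \<Longrightarrow> size H < size G"
  by (cases p) (auto simp: size_left_option size_right_option)

text \<open>\<open>wins_first p G\<close>: player \<open>p\<close> has a winning strategy in \<open>G\<close> when \<open>p\<close> makes the first move,
  under the convention that a player unable to move loses.\<close>

fun wins_first :: "player \<Rightarrow> game \<Rightarrow> bool" where
  "wins_first p G \<longleftrightarrow> (\<exists>H |\<in>| opts p G. \<not> wins_first (opponent p) H)"

declare wins_first.simps [simp del]

datatype outcome = Left_Wins | Right_Wins | Next_Wins | Previous_Wins

definition outcome :: "game \<Rightarrow> outcome" where
  "outcome G =
     (if wins_first Left G
      then (if wins_first Right G then Next_Wins else Left_Wins)
      else (if wins_first Right G then Right_Wins else Previous_Wins))"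

fun disj_sum :: "game \<Rightarrow> game \<Rightarrow> game" (infixl \<open>\<oplus>\<close> 65) where
  "G \<oplus> H =
     Game (((\<lambda>G'. G' \<oplus> H) |`| left_opts G) |\<union>| ((\<lambda>H'. G \<oplus> H') |`| left_opts H))
          (((\<lambda>G'. G' \<oplus> H) |`| right_opts G) |\<union>| ((\<lambda>H'. G \<oplus> H') |`| right_opts H))"

declare disj_sum.simps [simp del]

definition game_eq :: "game \<Rightarrow> game \<Rightarrow> bool" (infix \<open>\<doteq>\<close> 50) where
  "Y \<doteq> Z \<longleftrightarrow> (\<forall>X. outcome (X \<oplus> Y) = outcome (X \<oplus> Z))"


section \<open>Digraph placement\<close>

datatype colour = Blue | Red

definition place :: "('a, 'b) pre_digraph \<Rightarrow> 'a \<Rightarrow> ('a, 'b) pre_digraph" where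
  "place G v = G \<restriction> (verts G - ({v} \<union> {w. v \<rightarrow>\<^bsub>G\<^esub> w}))"

text \<open>The vertex set is finite in every use; the value on infinite digraphs is a dummy. On finite
  digraphs, \<^term>\<open>Abs_fset\<close> merely turns a finite set into a value of type \<^typ>\<open>'a fset\<close>.\<close>

function placement_game :: "('a, 'b) pre_digraph \<Rightarrow> ('a \<Rightarrow> colour) \<Rightarrow> game" where
  "placement_game G c =
     (if finite (verts G)
      then Game ((\<lambda>v. placement_game (place G v) c) |`| Abs_fset {v \<in> verts G. c v = Blue})
                ((\<lambda>v. placement_game (place G v) c) |`| Abs_fset {v \<in> verts G. c v = Red})
      else Game {||} {||})"
  by pat_completeness auto
termination
  by (relation "measure (\<lambda>(G, c). card (verts G))")
    (auto simp: place_def Abs_fset_inverse intro!: psubset_card_mono)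

declare placement_game.simps [simp del]

end

theory Submission
  imports Defs
begin

text \<open>
  By induction every option \<open>Y\<close> of \<open>X\<close> is realised by a digraph. Take disjoint copies of these
  digraphs and, for each option, a vertex that deletes everything except the corresponding copy.
  The remaining moves, namely those inside the copies, have to be made harmless. To this end we add
  four gates, cyclically ordered with alternating colours, and for each gate a large independent set
  of its colour. Every unwanted first move by one player can be answered by the opponent at a gate
  in such a way that only an independent set of the opponent's colour remains. This is an integer so
  favourable to the opponent that it beats \<open>X\<close>, and it offers the first player no move, so the
  unwanted move reverses out.
\<close>

section \<open>Equality of games\<close>

text \<open>Tracking each starting player separately lets inductions unfold one
  \<open>wins_first\<close> at a time instead of comparing outcomes.\<close>

definition equivalent :: "game \<Rightarrow> game \<Rightarrow> bool" where
  "equivalent G H \<longleftrightarrow> (\<forall>Z p. wins_first p (Z \<oplus> G) \<longleftrightarrow> wins_first p (Z \<oplus> H))"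

lemma equivalent_imp_game_eq: "equivalent G H \<Longrightarrow> G \<doteq> H"
  by (simp add: equivalent_def game_eq_def outcome_def)

lemma opponent_opponent [simp]: "opponent (opponent p) = p"
  by (cases p) auto

lemma opponent_neq [simp]: "opponent p \<noteq> p" "p \<noteq> opponent p"
  by (cases p; simp)+

lemma mem_opts_disj_sum:
  "K |\<in>| opts p (G \<oplus> H) \<longleftrightarrow>
     (\<exists>G'. G' |\<in>| opts p G \<and> K = G' \<oplus> H) \<or> (\<exists>H'. H' |\<in>| opts p H \<and> K = G \<oplus> H')"
  by (cases p) (auto simp: disj_sum.simps[of G H])

lemma wins_first_disj_sum:
  "wins_first p (G \<oplus> H) \<longleftrightarrow>
     (\<exists>G'. G' |\<in>| opts p G \<and> \<not> wins_first (opponent p) (G' \<oplus> H)) \<or>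
     (\<exists>H'. H' |\<in>| opts p H \<and> \<not> wins_first (opponent p) (G \<oplus> H'))"
proof -
  have "wins_first p (G \<oplus> H) \<longleftrightarrow> (\<exists>K. K |\<in>| opts p (G \<oplus> H) \<and> \<not> wins_first (opponent p) K)"
    by (subst wins_first.simps) (auto elim: fBexE intro: fBexI)
  then show ?thesis by (auto simp: mem_opts_disj_sum)
qed

section \<open>Integers and reversible moves\<close>

text \<open>These are the integers: \<open>n\<close> for Left and \<open>-n\<close> for
  Right.\<close>

fun free_moves :: "player \<Rightarrow> nat \<Rightarrow> game" where
  "free_moves p 0 = Game {||} {||}"
| "free_moves Left (Suc n) = Game {|free_moves Left n|} {||}"
| "free_moves Right (Suc n) = Game {||} {|free_moves Right n|}"

lemma opts_empty_game [simp]: "opts q (Game {||} {||}) = {||}"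
  by (cases q) auto

lemma opts_free_moves_Suc [simp]:
  "opts q (free_moves p (Suc n)) = (if q = p then {|free_moves p n|} else {||})"
  by (cases p; cases q) auto

lemma opts_opponent_free_moves [simp]: "opts (opponent p) (free_moves p n) = {||}"
  by (cases n) auto

text \<open>The opponent has no move in the integer, so all his moves there are in \<open>Z\<close>
  and can be copied. The owner matches a move in \<open>X\<close> by spending one free move; since
  options have smaller size, the bound \<open>size X \<le> n\<close> persists.\<close>

lemma free_moves_favour_owner:
  assumes "size X \<le> n"
  shows "(wins_first (opponent p) (Z \<oplus> free_moves p n) \<longrightarrow> wins_first (opponent p) (Z \<oplus> X)) \<and>
    (wins_first p (Z \<oplus> X) \<longrightarrow> wins_first p (Z \<oplus> free_moves p n))"
  using assms
proof (induction "size Z + n" arbitrary: Z n X rule: less_induct)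
  case less
  have IH: "(wins_first (opponent p) (Z' \<oplus> free_moves p n) \<longrightarrow> wins_first (opponent p) (Z' \<oplus> X)) \<and>
      (wins_first p (Z' \<oplus> X) \<longrightarrow> wins_first p (Z' \<oplus> free_moves p n))"
    if "Z' |\<in>| opts q Z" for Z' q
    using less.hyps[of Z' n X] less.prems size_option[OF that] by simp
  have 1: "wins_first (opponent p) (Z \<oplus> X)" if "wins_first (opponent p) (Z \<oplus> free_moves p n)"
    using that IH by (auto simp: wins_first_disj_sum[of "opponent p" Z])
  have 2: "wins_first p (Z \<oplus> free_moves p n)" if "wins_first p (Z \<oplus> X)"
    using that unfolding wins_first_disj_sum[of p Z X]
  proof (elim disjE exE conjE)
    fix Z' assume "Z' |\<in>| opts p Z" "\<not> wins_first (opponent p) (Z' \<oplus> X)"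
    then show ?thesis using IH by (auto simp: wins_first_disj_sum[of p Z])
  next
    fix X' assume X': "X' |\<in>| opts p X" "\<not> wins_first (opponent p) (Z \<oplus> X')"
    from size_option[OF X'(1)] less.prems have "size X' < n" by simp
    then obtain m where m: "n = Suc m" "size X' \<le> m" by (cases n) auto
    then have "\<not> wins_first (opponent p) (Z \<oplus> free_moves p m)"
      using X'(2) less.hyps[of Z m X'] by auto
    then show ?thesis by (auto simp: wins_first_disj_sum[of p Z] m)
  qed
  show ?case using 1 2 by blast
qed

text \<open>Moves in \<open>Z\<close> are handled by induction. If \<open>p\<close> wins by moving
  to an unmatched \<open>H\<close>, then \<open>p\<close> also wins after the reply to the integer.
  That integer is at least as good for the opponent as \<open>X\<close>, so \<open>p\<close> already
  wins moving first in \<open>Z \<oplus> X\<close>.\<close>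

lemma equivalentI_reversible:
  assumes realised: "\<And>p Y. Y |\<in>| opts p X \<Longrightarrow> \<exists>H. H |\<in>| opts p G \<and> equivalent H Y"
    and harmless: "\<And>p H. H |\<in>| opts p G \<Longrightarrow>
      (\<exists>Y. Y |\<in>| opts p X \<and> equivalent H Y) \<or>
      (\<exists>n\<ge>size X. free_moves (opponent p) n |\<in>| opts (opponent p) H)"
  shows "equivalent G X"
proof -
  have "wins_first p (Z \<oplus> G) \<longleftrightarrow> wins_first p (Z \<oplus> X)" for p Z
  proof (induction "size Z" arbitrary: Z p rule: less_induct)
    case less
    have IH: "wins_first q (Z' \<oplus> G) \<longleftrightarrow> wins_first q (Z' \<oplus> X)" if "Z' |\<in>| opts p Z" for Z' q
      using less size_option[OF that] by blast
    show ?case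
    proof
      assume "wins_first p (Z \<oplus> G)"
      then show "wins_first p (Z \<oplus> X)"
        unfolding wins_first_disj_sum[of p Z G]
      proof (elim disjE exE conjE)
        fix Z' assume "Z' |\<in>| opts p Z" "\<not> wins_first (opponent p) (Z' \<oplus> G)"
        then show ?thesis using IH by (auto simp: wins_first_disj_sum[of p Z])
      next
        fix H assume H: "H |\<in>| opts p G" "\<not> wins_first (opponent p) (Z \<oplus> H)"
        from harmless[OF H(1)] show ?thesis
        proof (elim disjE exE conjE)
          fix Y assume "Y |\<in>| opts p X" "equivalent H Y"
          then show ?thesis using H(2) by (auto simp: wins_first_disj_sum[of p Z] equivalent_def)
        next
          fix n assume n: "size X \<le> n" "free_moves (opponent p) n |\<in>| opts (opponent p) H"
          then have "wins_first p (Z \<oplus> free_moves (opponent p) n)"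
            using H(2) by (auto simp: wins_first_disj_sum[of "opponent p" Z])
          then show ?thesis using free_moves_favour_owner[OF n(1), of "opponent p" Z] by simp
        qed
      qed
    next
      assume "wins_first p (Z \<oplus> X)"
      then show "wins_first p (Z \<oplus> G)"
        unfolding wins_first_disj_sum[of p Z X]
      proof (elim disjE exE conjE)
        fix Z' assume "Z' |\<in>| opts p Z" "\<not> wins_first (opponent p) (Z' \<oplus> X)"
        then show ?thesis using IH by (auto simp: wins_first_disj_sum[of p Z])
      next
        fix Y assume Y: "Y |\<in>| opts p X" "\<not> wins_first (opponent p) (Z \<oplus> Y)"
        from realised[OF Y(1)] show ?thesis
          using Y(2) by (auto simp: wins_first_disj_sum[of p Z] equivalent_def)
      qed
    qed
  qed
  then show ?thesis by (simp add: equivalent_def)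
qed


section \<open>Placement games of relations\<close>

text \<open>Here the relation stays fixed and only the vertex set shrinks, so positions need no
  induced subdigraphs. Loops are allowed.\<close>

function rel_game :: "('a \<Rightarrow> 'a \<Rightarrow> bool) \<Rightarrow> ('a \<Rightarrow> player) \<Rightarrow> 'a set \<Rightarrow> game" where
  "rel_game E own S =
     (if finite S
      then Game ((\<lambda>v. rel_game E own (S - {v} - {w. E v w})) |`| Abs_fset {v \<in> S. own v = Left})
                ((\<lambda>v. rel_game E own (S - {v} - {w. E v w})) |`| Abs_fset {v \<in> S. own v = Right})
      else Game {||} {||})"
  by pat_completeness auto
termination
  by (relation "measure (\<lambda>(E, own, S). card S)")
    (auto simp: Abs_fset_inverse intro!: psubset_card_mono)

declare rel_game.simps [simp del]

lemma mem_opts_rel_game: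
  assumes "finite S"
  shows "H |\<in>| opts p (rel_game E own S) \<longleftrightarrow>
    (\<exists>v \<in> S. own v = p \<and> H = rel_game E own (S - {v} - {w. E v w}))"
  using assms by (cases p) (auto simp: rel_game.simps[of E own S] Abs_fset_inverse)

lemma game_eqI_opts:
  assumes "\<And>p H. H |\<in>| opts p G \<longleftrightarrow> H |\<in>| opts p K"
  shows "G = K"
  using assms[of _ Left] assms[of _ Right] by (cases G; cases K) (auto intro!: fset_eqI)

text \<open>Moves commute with an injective renaming. Loops may differ, as a played vertex
  disappears anyway. With \<open>f = id\<close> this replaces a relation by one that agrees with it
  on distinct vertices of \<open>S\<close>.\<close>

lemma rel_game_image:
  assumes "finite S" "inj_on f S"
    and "\<And>v w. v \<in> S \<Longrightarrow> w \<in> S \<Longrightarrow> v \<noteq> w \<Longrightarrow> E' (f v) (f w) \<longleftrightarrow> E v w"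
    and "\<And>v. v \<in> S \<Longrightarrow> own' (f v) = own v"
  shows "rel_game E' own' (f ` S) = rel_game E own S"
  using assms
proof (induction "card S" arbitrary: S rule: less_induct)
  case less
  have step: "rel_game E' own' (f ` S - {f v} - {w. E' (f v) w}) = rel_game E own (S - {v} - {w. E v w})"
    if v: "v \<in> S" for v
  proof -
    have "f w = f v \<longleftrightarrow> w = v" if "w \<in> S" for w
      using v that less.prems(2) by (auto simp: inj_on_def)
    then have "f ` S - {f v} - {w. E' (f v) w} = f ` (S - {v} - {w. E v w})"
      using v less.prems(3) by (auto intro!: imageI)
    moreover have "card (S - {v} - {w. E v w}) < card S"
      using v less.prems(1) by (intro psubset_card_mono) auto
    ultimately show ?thesis
      using less.hyps[of "S - {v} - {w. E v w}"] less.prems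
      by (simp add: inj_on_diff)
  qed
  show ?case
    by (rule game_eqI_opts)
      (use less.prems(1,4) step in \<open>auto simp: mem_opts_rel_game\<close>)
qed

text \<open>Each move removes only the played vertex and leaves an independent set with one vertex
  fewer.\<close>

lemma rel_game_independent:
  assumes "finite S" "\<And>v w. v \<in> S \<Longrightarrow> w \<in> S \<Longrightarrow> v \<noteq> w \<Longrightarrow> \<not> E v w" "\<And>v. v \<in> S \<Longrightarrow> own v = p"
  shows "rel_game E own S = free_moves p (card S)"
  using assms
proof (induction "card S" arbitrary: S)
  case 0
  then show ?case by (intro game_eqI_opts) (auto simp: mem_opts_rel_game)
next
  case (Suc n)
  have step: "rel_game E own (S - {v} - {w. E v w}) = free_moves p n" if v: "v \<in> S" for v
  proof -
    have "S - {v} - {w. E v w} = S - {v}" using v Suc.prems(2) by auto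
    moreover have "n = card (S - {v})" using Suc.hyps(2) v Suc.prems(1) by simp
    ultimately show ?thesis using Suc.hyps(1)[of "S - {v}"] Suc.prems by simp
  qed
  have "S \<noteq> {}" using Suc.hyps(2) by auto
  then have "H |\<in>| opts q (rel_game E own S) \<longleftrightarrow> H |\<in>| opts q (free_moves p (Suc n))" for q H
    using Suc.prems(1,3) step by (auto simp: mem_opts_rel_game)
  then show ?case using Suc.hyps(2) by (metis game_eqI_opts)
qed

section \<open>Digraphs as relations\<close>

fun colour_of :: "player \<Rightarrow> colour" where
  "colour_of Left = Blue"
| "colour_of Right = Red"

lemma mem_opts_placement_game:
  assumes "finite (verts G)"
  shows "H |\<in>| opts p (placement_game G c) \<longleftrightarrow>
    (\<exists>v \<in> verts G. c v = colour_of p \<and> H = placement_game (place G v) c)"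
  using assms by (cases p) (auto simp: placement_game.simps[of G c] Abs_fset_inverse)

lemma placement_game_eq_rel_game:
  assumes "finite (verts G)"
  shows "placement_game G (\<lambda>v. colour_of (own v)) = rel_game (\<lambda>v w. v \<rightarrow>\<^bsub>G\<^esub> w) own (verts G)"
  using assms
proof (induction "card (verts G)" arbitrary: G rule: less_induct)
  case less
  have colour: "colour_of p = colour_of q \<longleftrightarrow> p = q" for p q
    by (cases p; cases q) auto
  have step: "placement_game (place G v) (\<lambda>v. colour_of (own v)) =
      rel_game (\<lambda>v w. v \<rightarrow>\<^bsub>G\<^esub> w) own (verts G - {v} - {w. v \<rightarrow>\<^bsub>G\<^esub> w})" if v: "v \<in> verts G" for v
  proof -
    have verts: "verts (place G v) = verts G - {v} - {w. v \<rightarrow>\<^bsub>G\<^esub> w}"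
      by (auto simp: place_def)
    have "card (verts (place G v)) < card (verts G)"
      unfolding verts using v less.prems by (intro psubset_card_mono) auto
    then have "placement_game (place G v) (\<lambda>v. colour_of (own v)) =
        rel_game (\<lambda>u w. u \<rightarrow>\<^bsub>place G v\<^esub> w) own (id ` verts (place G v))"
      using less.hyps[of "place G v"] less.prems verts by simp
    \<comment> \<open>The induced subdigraph has the same arcs as \<open>G\<close> between its
      vertices, so \<open>f = id\<close> applies.\<close>
    also have "\<dots> = rel_game (\<lambda>v w. v \<rightarrow>\<^bsub>G\<^esub> w) own (verts (place G v))"
      by (rule rel_game_image)
        (use less.prems verts in \<open>auto simp: place_def arcs_ends_def arc_to_ends_def\<close>)
    finally show ?thesis by (simp add: verts)
  qed
  show ?case
    by (rule game_eqI_opts)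
      (use less.prems step in \<open>auto simp: mem_opts_rel_game mem_opts_placement_game colour\<close>)
qed


section \<open>The construction\<close>

text \<open>The gates \<open>Gate Left False\<close>, \<open>Gate Right False\<close>, \<open>Gate Left True\<close>, \<open>Gate Right True\<close> are in
  cyclic order. The independent set \<open>Reserve p k\<close> belongs to the gate \<open>Gate p k\<close>.\<close>

datatype vertex =
  Choose player game | Gate player bool | Reserve player bool nat | Copy game nat

text \<open>The gate after \<open>Gate p k\<close> in the cycle is
  \<open>Gate (opponent p) (next_phase p k)\<close>.\<close>

fun next_phase :: "player \<Rightarrow> bool \<Rightarrow> bool" where
  "next_phase Left k = k"
| "next_phase Right k = (\<not> k)"

fun owner :: "(game \<Rightarrow> nat \<Rightarrow> player) \<Rightarrow> vertex \<Rightarrow> player" where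
  "owner own (Choose p Y) = p"
| "owner own (Gate p k) = p"
| "owner own (Reserve p k n) = p"
| "owner own (Copy Y x) = own Y x"

text \<open>This is the gate two places from \<open>Gate p k\<close>, with its reserve. It does not
  meet \<open>Reserve p k\<close>, so a reserve stays independent although its vertices delete
  \<open>opposite p k\<close>.\<close>

definition opposite :: "player \<Rightarrow> bool \<Rightarrow> vertex set" where
  "opposite p k = insert (Gate p (\<not> k)) (range (Reserve p (\<not> k)))"

text \<open>After \<open>Gate p k\<close>, the next gate leaves just its own reserve. The same position is reached by
  playing the next gate after a move that deletes \<open>opposite p k\<close>, since the gate following the next
  one is \<open>Gate p (\<not> k)\<close>.\<close>

fun deleted :: "(game \<Rightarrow> nat \<Rightarrow> nat \<Rightarrow> bool) \<Rightarrow> (game \<Rightarrow> nat \<Rightarrow> player) \<Rightarrow> vertex \<Rightarrow> vertex set" where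
  "deleted E own (Choose p Y) = - range (Copy Y)"
| "deleted E own (Gate p k) =
     - insert (Gate (opponent p) (next_phase p k))
         (range (Reserve p k) \<union> range (Reserve (opponent p) (next_phase p k)))"
| "deleted E own (Reserve p k n) = opposite p k"
| "deleted E own (Copy Y x) = opposite (own Y x) False \<union> Copy Y ` {y. E Y x y}"

text \<open>Reserves have \<open>size X\<close> vertices to meet the bound in
  \<open>free_moves_favour_owner\<close>. Copies are indexed by the option alone, so an option of
  both players has a single copy.\<close>

definition vertices :: "game \<Rightarrow> (game \<Rightarrow> nat set) \<Rightarrow> vertex set" where
  "vertices X S =
     (\<Union>p. Choose p ` fset (opts p X)) \<union> (\<Union>p. range (Gate p)) \<union>
     (\<Union>p k. Reserve p k ` {..<size X}) \<union> (\<Union>p. \<Union>Y\<in>fset (opts p X). Copy Y ` S Y)"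

lemma player_UNIV: "(UNIV :: player set) = {Left, Right}"
  using player.exhaust by auto

lemma finite_vertices:
  assumes "\<And>p Y. Y |\<in>| opts p X \<Longrightarrow> finite (S Y)"
  shows "finite (vertices X S)"
  using assms[of _ Left] assms[of _ Right]
  by (auto simp: vertices_def player_UNIV UNIV_bool)

lemma next_phase_next_phase [simp]:
  "next_phase (opponent p) (next_phase p k) = (\<not> k)"
  by (cases p) auto

lemma mem_vertices_simps:
  "Choose p Y \<in> vertices X S \<longleftrightarrow> Y |\<in>| opts p X"
  "Gate p k \<in> vertices X S"
  "Reserve p k n \<in> vertices X S \<longleftrightarrow> n < size X"
  "Copy Y x \<in> vertices X S \<longleftrightarrow> (\<exists>p. Y |\<in>| opts p X) \<and> x \<in> S Y"
  by (auto simp: vertices_def image_iff)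

lemma Choose_leaves_copy:
  assumes "Y |\<in>| opts p X"
  shows "vertices X S - {Choose p Y} - deleted E own (Choose p Y) = Copy Y ` S Y"
  using assms by (auto simp: mem_vertices_simps)

text \<open>The answer is the next gate. It would spare, besides its own reserve, only the gate and
  reserve opposite to the first move, and these are already gone.\<close>

lemma unwanted_move_answer:
  fixes E :: "game \<Rightarrow> nat \<Rightarrow> nat \<Rightarrow> bool" and own :: "game \<Rightarrow> nat \<Rightarrow> player"
  assumes v: "v \<in> vertices X S" "\<And>p Y. v \<noteq> Choose p Y"
  defines "T \<equiv> vertices X S - {v} - deleted E own v"
  obtains k where "Gate (opponent (owner own v)) k \<in> T"
    "T - {Gate (opponent (owner own v)) k} - deleted E own (Gate (opponent (owner own v)) k) =
       Reserve (opponent (owner own v)) k ` {..<size X}"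
proof (cases v)
  case (Choose p Y)
  then show ?thesis using v by blast
next
  case (Gate p k)
  show ?thesis
    by (rule that[of "next_phase p k"])
      (use Gate in \<open>auto simp: T_def mem_vertices_simps\<close>)
next
  case (Reserve p k n)
  show ?thesis
    by (rule that[of "next_phase p k"])
      (use Reserve in \<open>auto simp: T_def mem_vertices_simps opposite_def\<close>)
next
  case (Copy Y x)
  \<comment> \<open>All copy vertices of an owner \<open>p\<close> delete
    \<open>opposite p False\<close>, so they are answered like \<open>Gate p False\<close>.\<close>
  show ?thesis
    by (rule that[of "next_phase (own Y x) False"])
      (use Copy in \<open>auto simp: T_def mem_vertices_simps opposite_def\<close>)
qed

text \<open>The \<open>Choose\<close> vertices realise the options of \<open>X\<close>; every other
  move reverses through a gate to an integer.\<close>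

lemma equivalent_construction:
  assumes fin: "\<And>p Y. Y |\<in>| opts p X \<Longrightarrow> finite (S Y)"
    and eqv: "\<And>p Y. Y |\<in>| opts p X \<Longrightarrow> equivalent (rel_game (E Y) (own Y) (S Y)) Y"
  shows "equivalent (rel_game (\<lambda>v w. w \<in> deleted E own v) (owner own) (vertices X S)) X"
    (is "equivalent (rel_game ?E ?own ?V) X")
proof (rule equivalentI_reversible)
  have finV: "finite ?V" using fin by (rule finite_vertices)
  have copy: "equivalent (rel_game ?E ?own (?V - {Choose p Y} - {w. ?E (Choose p Y) w})) Y"
    if Y: "Y |\<in>| opts p X" for p Y
  proof -
    \<comment> \<open>\<open>opposite\<close> contains only gates and reserves, so inside a copy
      just \<open>E Y\<close> acts.\<close>
    have "rel_game ?E ?own (Copy Y ` S Y) = rel_game (E Y) (own Y) (S Y)"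
      by (rule rel_game_image) (use fin[OF Y] in \<open>auto simp: inj_on_def opposite_def\<close>)
    moreover have "?V - {Choose p Y} - {w. ?E (Choose p Y) w} = Copy Y ` S Y"
      using Choose_leaves_copy[OF Y] by (simp del: deleted.simps)
    ultimately show ?thesis using eqv[OF Y] by metis
  qed
  show "\<exists>H. H |\<in>| opts p (rel_game ?E ?own ?V) \<and> equivalent H Y" if "Y |\<in>| opts p X" for p Y
    using copy[OF that] that finV
    by (metis mem_opts_rel_game mem_vertices_simps(1) owner.simps(1))
  fix p H assume "H |\<in>| opts p (rel_game ?E ?own ?V)"
  then obtain v where v: "v \<in> ?V" "?own v = p" "H = rel_game ?E ?own (?V - {v} - {w. ?E v w})"
    using finV by (auto simp: mem_opts_rel_game)
  show "(\<exists>Y. Y |\<in>| opts p X \<and> equivalent H Y) \<or>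
      (\<exists>n\<ge>size X. free_moves (opponent p) n |\<in>| opts (opponent p) H)"
  proof (cases "\<exists>q Y. v = Choose q Y")
    case True
    then obtain Y where "v = Choose p Y" using v(2) by auto
    moreover from this have "Y |\<in>| opts p X" using v(1) by (simp add: mem_vertices_simps)
    ultimately show ?thesis using copy v(3) by blast
  next
    case False
    define T where "T = ?V - {v} - deleted E own v"
    obtain k where k: "Gate (opponent p) k \<in> T"
      "T - {Gate (opponent p) k} - deleted E own (Gate (opponent p) k) =
         Reserve (opponent p) k ` {..<size X}"
      using unwanted_move_answer[OF v(1), where E = E and own = own] False v(2) unfolding T_def by metis
    let ?R = "Reserve (opponent p) k ` {..<size X}"
    have "rel_game ?E ?own ?R = free_moves (opponent p) (card ?R)"
      by (rule rel_game_independent) (auto simp: opposite_def)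
    moreover have "card ?R = size X"
      by (simp add: card_image inj_on_def)
    moreover have "rel_game ?E ?own ?R |\<in>| opts (opponent p) (rel_game ?E ?own T)"
    proof -
      have "T - {Gate (opponent p) k} - {w. ?E (Gate (opponent p) k) w} = ?R"
        using k(2) by (simp del: deleted.simps)
      then have "owner own (Gate (opponent p) k) = opponent p \<and> rel_game ?E ?own ?R =
          rel_game ?E ?own (T - {Gate (opponent p) k} - {w. ?E (Gate (opponent p) k) w})"
        by (simp del: deleted.simps)
      moreover have "finite T" using finV by (simp add: T_def)
      ultimately show ?thesis using k(1) by (blast intro: mem_opts_rel_game[THEN iffD2])
    qed
    moreover have "H = rel_game ?E ?own T" using v(3) by (simp add: T_def set_diff_eq)
    ultimately show ?thesis by (metis order_refl)
  qed
qed

section \<open>Universality by induction on the options\<close>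

lemma rel_game_universal:
  "\<exists>(E :: nat \<Rightarrow> nat \<Rightarrow> bool) own S. finite S \<and> equivalent (rel_game E own S) X"
proof (induction "size X" arbitrary: X rule: less_induct)
  case less
  \<comment> \<open>Quantifying over all \<open>Y\<close> lets choice produce functions
    \<open>E\<close>, \<open>own\<close>, \<open>S\<close>; their values off the options of
    \<open>X\<close> are arbitrary.\<close>
  have "\<forall>Y. \<exists>(E :: nat \<Rightarrow> nat \<Rightarrow> bool) own S.
      (\<exists>p. Y |\<in>| opts p X) \<longrightarrow> finite S \<and> equivalent (rel_game E own S) Y"
  proof
    fix Y
    show "\<exists>(E :: nat \<Rightarrow> nat \<Rightarrow> bool) own S.
      (\<exists>p. Y |\<in>| opts p X) \<longrightarrow> finite S \<and> equivalent (rel_game E own S) Y"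
    proof (cases "\<exists>p. Y |\<in>| opts p X")
      case True
      then have "size Y < size X" using size_option by blast
      from less[OF this] show ?thesis by blast
    qed simp
  qed
  then obtain E :: "game \<Rightarrow> nat \<Rightarrow> nat \<Rightarrow> bool" and own S where
    ES: "\<And>Y. (\<exists>p. Y |\<in>| opts p X) \<Longrightarrow> finite (S Y) \<and> equivalent (rel_game (E Y) (own Y) (S Y)) Y"
    by metis
  define V where "V = vertices X S"
  define D where "D = (\<lambda>v w. w \<in> deleted E own v)"
  have fin: "finite V" using ES unfolding V_def by (intro finite_vertices) blast
  have eqv: "equivalent (rel_game D (owner own) V) X"
    unfolding D_def V_def by (rule equivalent_construction) (use ES in blast)+
  \<comment> \<open>Numbering the vertices returns to type \<open>nat\<close>, which
    \<open>Copy\<close> requires at the next stage of the induction.\<close>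
  obtain f :: "vertex \<Rightarrow> nat" where f: "inj_on f V"
    using finite_imp_inj_to_nat_seg[OF fin] by auto
  let ?g = "inv_into V f"
  have "rel_game (\<lambda>m n. D (?g m) (?g n)) (\<lambda>n. owner own (?g n)) (f ` V) = rel_game D (owner own) V"
    by (rule rel_game_image) (use fin f in auto)
  with eqv have "equivalent (rel_game (\<lambda>m n. D (?g m) (?g n)) (\<lambda>n. owner own (?g n)) (f ` V)) X"
    by simp
  then show ?case using fin by blast
qed

theorem theorem7:
  fixes X :: game
  shows "\<exists>(G :: nat pair_pre_digraph) (c :: nat \<Rightarrow> colour).
           pair_digraph G \<and> placement_game (with_proj G) c \<doteq> X"
proof -
  obtain E :: "nat \<Rightarrow> nat \<Rightarrow> bool" and own S where
    S: "finite S" and eqv: "equivalent (rel_game E own S) X"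
    using rel_game_universal by blast
  \<comment> \<open>A \<open>pair_digraph\<close> is loop-free with arcs between its own vertices,
    so \<open>E\<close> is restricted accordingly; \<open>rel_game_image\<close> shows that the game
    is unchanged.\<close>
  define G where "G = \<lparr>pverts = S, parcs = {(v, w) \<in> S \<times> S. v \<noteq> w \<and> E v w}\<rparr>"
  have fin_arcs: "finite (parcs G)"
    using S by (auto simp: G_def intro: finite_subset[of _ "S \<times> S"])
  have "pair_digraph G"
    by unfold_locales (use S fin_arcs in \<open>auto simp: G_def\<close>)
  moreover have "placement_game (with_proj G) (\<lambda>v. colour_of (own v)) =
      rel_game (\<lambda>v w. v \<rightarrow>\<^bsub>with_proj G\<^esub> w) own (id ` S)"
    using placement_game_eq_rel_game[of "with_proj G" own] S by (simp add: G_def)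
  moreover have "rel_game (\<lambda>v w. v \<rightarrow>\<^bsub>with_proj G\<^esub> w) own (id ` S) = rel_game E own S"
    by (rule rel_game_image) (use S in \<open>auto simp: G_def arcs_ends_def arc_to_ends_def\<close>)
  ultimately show ?thesis
    using equivalent_imp_game_eq[OF eqv] by metis
qed

end
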